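(* Let $p,q,r$ be pairwise distinct primes with $p<q$ and $p<r$, and let $A=\max_n |a_{pqr}(n)|$. Let $q',r'\in\{1,\dots,p-1\}$ be the inverses of $q$ and $r$ modulo $p$, let $\alpha=\min\{q',r',p-q',p-r'\}$, let $\beta$ be the unique integer with $0<\beta<p$ and $\alpha\beta qr\equiv 1\pmod p$, and put $\beta^*=\min\{\beta,p-\beta\}$. Then $$A\le \min\{2\alpha+\beta^*,\;p-\beta^*\}.$$
   Context: $\Phi_{pqr}(x)=\prod_{0<k<pqr,\ \gcd(k,pqr)=1}(x-\zeta^k)$, where $\zeta$ is a primitive $pqr$-th root of unity, is the ternary cyclotomic polynomial; $a_{pqr}(n)$ denotes its coefficient of $x^n$ (zero for $n$ outside $[0,\deg\Phi_{pqr}]$). *)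

theory Defs
  imports "HOL-Computational_Algebra.Polynomial" "HOL-Number_Theory.Cong" Complex_Main
begin

definition cyclotomic :: "nat \<Rightarrow> complex poly" where
  "cyclotomic n = (\<Prod>k\<in>{k. 0 < k \<and> k < n \<and> coprime k n}.
      [:- ((exp (2 * of_real pi * \<i> / of_nat n)) ^ k), 1:])"

definition cyc_coeff :: "nat \<Rightarrow> nat \<Rightarrow> complex" where
  "cyc_coeff n m = coeff (cyclotomic n) m"

definition max_abs_coeff :: "nat \<Rightarrow> real" where
  "max_abs_coeff n = Max ((\<lambda>m. cmod (cyc_coeff n m)) ` {..degree (cyclotomic n)})"

end

theory Submission
  imports Defs "HOL-Computational_Algebra.Polynomial_FPS"
begin

text \<open>
  Every integer \<open>m\<close> is uniquely \<open>x q r + y p r + z p q + t p q r\<close> with \<open>0 \<le> x < p\<close>, \<open>0 \<le> y < q\<close>,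
  \<open>0 \<le> z < r\<close>, and the series \<open>(1 - X^(pqr)) / ((1 - X^(pq)) (1 - X^(pr)) (1 - X^(qr)))\<close> has
  coefficients \<open>max (t + 1) 0\<close>. Multiplying by \<open>(1 - X^p) (1 - X^q) (1 - X^r) / (1 - X)\<close>, the \<open>n\<close>-th
  coefficient of the cyclotomic polynomial becomes a sum over the window \<open>n - p < m \<le> n\<close> of mixed second
  differences of \<open>max (t + 1) 0\<close> with steps \<open>q\<close> and \<open>r\<close>. A step \<open>q\<close> changes \<open>t\<close> only according to
  whether \<open>x < r'\<close> and whether \<open>z\<close> is less than the inverse of \<open>p\<close> modulo \<open>r\<close>, and symmetrically
  for a step \<open>r\<close>.

  Since \<open>x\<close> runs through all residues once in the window, the number of \<open>m\<close> with \<open>x\<close> in a given range is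
  the length of that range; this gives the bound \<open>p - \<beta>\<^sup>*\<close>. On the two long ranges a nonzero
  second difference moreover fixes \<open>t\<close> and pins \<open>y / q\<close> and \<open>z / r\<close> to short intervals. As
  \<open>x / p + y / q + z / r + t = m / (p q r)\<close> is nearly constant on the window, at most \<open>\<alpha> + \<beta>\<^sup>*\<close>
  values of \<open>x\<close> remain, which gives \<open>2 \<alpha> + \<beta>\<^sup>*\<close>. Here \<open>\<alpha>\<close> and \<open>\<beta>\<^sup>*\<close> are simply the smaller and the
  larger of the distances of \<open>q'\<close> and \<open>r'\<close> to the nearest multiple of \<open>p\<close>.
\<close>

section \<open>The cyclotomic polynomial as a quotient\<close>

lemma exp_root_unity_power:
  "exp (2 * of_real pi * \<i> / of_nat n) ^ k = cis (2 * pi * real k / real n)"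
  by (simp add: cis_conv_exp flip: exp_of_nat_mult) (simp add: mult_ac)

text \<open>Both sides are monic of degree \<open>n\<close> and agree at the \<open>n\<close> roots
  of unity.\<close>

lemma prod_linear_roots_unity:
  fixes n :: nat
  assumes "n > 0"
  shows "(\<Prod>k<n. [:- cis (2 * pi * real k / real n), 1:]) = monom 1 n - 1"
proof (rule poly_eqI_degree_lead_coeff[where n = n and A = "{z. z ^ n = 1}"])
  let ?f = "\<lambda>k. cis (2 * pi * real k / real n)"
  let ?P = "\<Prod>k<n. [:- ?f k, 1:]"
  have deg: "degree ?P = n"
    by (subst degree_prod_eq_sum_degree) auto
  have "coeff ?P n = 1"
    using lead_coeff_prod[of "\<lambda>k. [:- ?f k, 1:]" "{..<n}"] deg by simp
  then show "coeff ?P n = coeff (monom 1 n - 1) n"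
    using assms by simp
  show "card {z::complex. z ^ n = 1} \<ge> n"
    using bij_betw_same_card[OF bij_betw_roots_unity[OF assms]] by simp
  show "degree ?P \<le> n" using deg by simp
  show "degree (monom (1::complex) n - 1) \<le> n"
    by (rule degree_diff_le) (auto simp: degree_monom_le)
  fix z :: complex assume z: "z \<in> {z. z ^ n = 1}"
  then obtain k where "k < n" "z = ?f k"
    using bij_betw_roots_unity[OF assms] unfolding bij_betw_def by blast
  then have "poly ?P z = 0"
    by (auto simp: poly_prod)
  with z show "poly ?P z = poly (monom 1 n - 1) z"
    by (simp add: poly_monom)
qed

text \<open>Among the roots of unity of order dividing \<open>d * e\<close>, the indices divisible
  by \<open>d\<close> give exactly the \<open>e\<close>-th roots of unity.\<close>

lemma prod_linear_roots_unity_multiples: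
  fixes d e :: nat
  assumes "d > 0" "e > 0"
  shows "(\<Prod>k\<in>{k. k < d * e \<and> d dvd k}. [:- cis (2 * pi * real k / real (d * e)), 1:])
    = monom 1 e - 1"
proof -
  have "(\<Prod>k\<in>{k. k < d * e \<and> d dvd k}. [:- cis (2 * pi * real k / real (d * e)), 1:])
      = (\<Prod>j<e. [:- cis (2 * pi * real j / real e), 1:])"
    by (rule prod.reindex_bij_witness[where i = "\<lambda>j. d * j" and j = "\<lambda>k. k div d"])
       (use assms in \<open>auto simp: field_simps elim!: dvdE\<close>)
  then show ?thesis
    using prod_linear_roots_unity[OF assms(2)] by simp
qed

text \<open>A crude bound, enough to confine the maximum to coefficient indices below
  \<open>p * q * r\<close>, where \<open>T\<close> is nonpositive.\<close>

lemma degree_cyclotomic_less: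
  assumes "n > 0"
  shows "degree (cyclotomic n) < n"
proof -
  have "degree (cyclotomic n) = card {k. 0 < k \<and> k < n \<and> coprime k n}"
    unfolding cyclotomic_def by (subst degree_prod_eq_sum_degree) auto
  also have "\<dots> \<le> card {1..<n}"
    by (rule card_mono) auto
  finally show ?thesis using assms by simp
qed

text \<open>A commutative monoid has no inverses, so the factors that inclusion-exclusion divides by
  stand on the left.\<close>

lemma prod_inclusion_exclusion3:
  fixes f :: "'a \<Rightarrow> 'b::comm_monoid_mult"
  assumes "finite A" "finite B" "finite C"
  shows "prod f (A \<union> B \<union> C) * prod f (A \<inter> B) * prod f (A \<inter> C) * prod f (B \<inter> C)
    = prod f A * prod f B * prod f C * prod f (A \<inter> B \<inter> C)"
proof -
  have 1: "prod f (A \<union> B \<union> C) * prod f ((A \<union> B) \<inter> C) = prod f (A \<union> B) * prod f C"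
    using assms by (intro prod.union_inter) auto
  have 2: "prod f (A \<union> B) * prod f (A \<inter> B) = prod f A * prod f B"
    using assms by (intro prod.union_inter) auto
  have "prod f ((A \<inter> C) \<union> (B \<inter> C)) * prod f ((A \<inter> C) \<inter> (B \<inter> C)) = prod f (A \<inter> C) * prod f (B \<inter> C)"
    using assms by (intro prod.union_inter) auto
  moreover have "(A \<inter> C) \<union> (B \<inter> C) = (A \<union> B) \<inter> C" "(A \<inter> C) \<inter> (B \<inter> C) = A \<inter> B \<inter> C"
    by auto
  ultimately have 3: "prod f ((A \<union> B) \<inter> C) * prod f (A \<inter> B \<inter> C) = prod f (A \<inter> C) * prod f (B \<inter> C)"
    by simp
  have "prod f (A \<union> B \<union> C) * prod f (A \<inter> B) * prod f (A \<inter> C) * prod f (B \<inter> C)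
      = prod f (A \<union> B \<union> C) * prod f (A \<inter> B) * (prod f ((A \<union> B) \<inter> C) * prod f (A \<inter> B \<inter> C))"
    unfolding 3 by (simp add: mult_ac)
  also have "\<dots> = (prod f (A \<union> B \<union> C) * prod f ((A \<union> B) \<inter> C)) * prod f (A \<inter> B) * prod f (A \<inter> B \<inter> C)"
    by (simp add: mult_ac)
  also have "\<dots> = (prod f (A \<union> B) * prod f (A \<inter> B)) * prod f C * prod f (A \<inter> B \<inter> C)"
    unfolding 1 by (simp add: mult_ac)
  finally show ?thesis unfolding 2 by (simp add: mult_ac)
qed

text \<open>An index is not coprime to \<open>p * q * r\<close> exactly when one of the primes
  divides it. Inclusion-exclusion over their multiples gives a quotient, stated with denominators
  cleared.\<close>

lemma cyclotomic_ternary: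
  fixes p q r :: nat
  assumes "prime p" "prime q" "prime r" "p \<noteq> q" "p \<noteq> r" "q \<noteq> r"
  shows "cyclotomic (p * q * r) * (monom 1 1 - 1) * (monom 1 (p * q) - 1) *
      (monom 1 (p * r) - 1) * (monom 1 (q * r) - 1) =
    (monom 1 (p * q * r) - 1) * (monom 1 p - 1) * (monom 1 q - 1) * (monom 1 r - 1)"
proof -
  define n where "n = p * q * r"
  define f where "f = (\<lambda>k. [:- cis (2 * pi * real k / real n), 1:])"
  define M where "M = (\<lambda>d. {k. k < n \<and> d dvd k})"
  have pos: "p > 0" "q > 0" "r > 0" using assms prime_gt_0_nat by auto
  have cop: "coprime p q" "coprime p r" "coprime q r"
    using assms primes_coprime by auto
  have fin: "finite (M d)" for d unfolding M_def by auto
  have prodM: "prod f (M d) = monom 1 e - 1" if "d * e = n" for d e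
  proof -
    have "d > 0" "e > 0" using that pos unfolding n_def by (auto intro!: Nat.gr0I)
    then show ?thesis
      using prod_linear_roots_unity_multiples[of d e] that unfolding f_def M_def by simp
  qed
  have I: "M p \<inter> M q = M (p * q)" "M p \<inter> M r = M (p * r)" "M q \<inter> M r = M (q * r)"
    unfolding M_def using cop by (auto intro: divides_mult dvd_mult_left dvd_mult_right)
  have "coprime (p * q) r" using cop by simp
  then have I3: "M p \<inter> M q \<inter> M r = M n"
    unfolding I(1) unfolding M_def n_def
    by (auto intro: divides_mult dvd_mult_left dvd_mult_right)
  have cyc: "cyclotomic n = prod f {k. 0 < k \<and> k < n \<and> coprime k n}"
    unfolding cyclotomic_def f_def exp_root_unity_power ..
  have n1: "n > 1"
    using assms prime_gt_1_nat pos unfolding n_def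
    by (metis less_1_mult)
  have cop_iff: "coprime k n \<longleftrightarrow> \<not> p dvd k \<and> \<not> q dvd k \<and> \<not> r dvd k" for k
    unfolding n_def using assms
    by (metis coprime_commute coprime_mult_right_iff prime_imp_coprime coprime_absorb_left not_prime_unit)
  \<comment> \<open>Index 0, left out of the coprime set, is a multiple of \<open>p\<close>.\<close>
  have split: "M 1 = {k. 0 < k \<and> k < n \<and> coprime k n} \<union> (M p \<union> M q \<union> M r)"
    unfolding M_def cop_iff using n1 by (auto intro!: Nat.gr0I)
  have disj: "{k. 0 < k \<and> k < n \<and> coprime k n} \<inter> (M p \<union> M q \<union> M r) = {}"
    unfolding M_def cop_iff by auto
  have total: "prod f (M 1) = cyclotomic n * prod f (M p \<union> M q \<union> M r)"
    unfolding split cyc by (rule prod.union_disjoint) (use fin disj in auto)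
  have ie: "prod f (M p \<union> M q \<union> M r) * prod f (M (p * q)) * prod f (M (p * r)) * prod f (M (q * r))
      = prod f (M p) * prod f (M q) * prod f (M r) * prod f (M n)"
    using prod_inclusion_exclusion3[OF fin fin fin, of f p q r] unfolding I3 unfolding I .
  have e: "prod f (M 1) = monom 1 n - 1" "prod f (M p) = monom 1 (q * r) - 1"
    "prod f (M q) = monom 1 (p * r) - 1" "prod f (M r) = monom 1 (p * q) - 1"
    "prod f (M (p * q)) = monom 1 r - 1" "prod f (M (p * r)) = monom 1 q - 1"
    "prod f (M (q * r)) = monom 1 p - 1" "prod f (M n) = monom 1 1 - 1"
    by (rule prodM; simp add: n_def mult_ac)+
  have "cyclotomic n * (prod f (M p) * prod f (M q) * prod f (M r) * prod f (M n))
     = prod f (M 1) * (prod f (M (p * q)) * prod f (M (p * r)) * prod f (M (q * r)))"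
    unfolding ie[symmetric] total by (simp add: mult_ac)
  then show ?thesis
    unfolding e n_def[symmetric] by (simp add: mult_ac)
qed

section \<open>Mixed-radix coordinates\<close>

text \<open>The identity makes \<open>u\<close>, \<open>v\<close>, \<open>w\<close> the inverses of
  \<open>q r\<close> modulo \<open>p\<close>, of \<open>p r\<close> modulo \<open>q\<close> and of
  \<open>p q\<close> modulo \<open>r\<close>.\<close>

locale ternary_coordinates =
  fixes p q r :: nat and u v w :: int
  assumes pos: "0 < p" "0 < q" "0 < r"
    and bezout: "u * (int q * int r) + v * (int p * int r) + w * (int p * int q) = 1"
begin

definition X :: "int \<Rightarrow> int" where "X m = m * u mod int p"
definition Y :: "int \<Rightarrow> int" where "Y m = m * v mod int q"
definition Z :: "int \<Rightarrow> int" where "Z m = m * w mod int r"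
definition T :: "int \<Rightarrow> int" where "T m = m * u div int p + m * v div int q + m * w div int r"

lemma coordinates_range: "0 \<le> X m" "X m < int p" "0 \<le> Y m" "Y m < int q" "0 \<le> Z m" "Z m < int r"
  using pos by (simp_all add: X_def Y_def Z_def)

text \<open>Multiply \<open>bezout\<close> by \<open>m\<close> and divide \<open>m * u\<close>,
  \<open>m * v\<close>, \<open>m * w\<close> with remainder; each quotient contributes a multiple of
  \<open>p q r\<close>, and \<open>T\<close> is their sum.\<close>

lemma decomposition:
  "m = X m * (int q * int r) + Y m * (int p * int r) + Z m * (int p * int q)
      + T m * (int p * int q * int r)"
proof -
  define a b c where "a = m * u div int p" and "b = m * v div int q" and "c = m * w div int r"
  have "m * u = X m + int p * a" "m * v = Y m + int q * b" "m * w = Z m + int r * c"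
    by (simp_all add: X_def Y_def Z_def a_def b_def c_def)
  moreover have "T m = a + b + c" by (simp add: T_def a_def b_def c_def)
  moreover have "m = (m * u) * (int q * int r) + (m * v) * (int p * int r) + (m * w) * (int p * int q)"
    using arg_cong[OF bezout, of "\<lambda>x. m * x"] by (simp add: algebra_simps)
  ultimately show ?thesis by (simp add: algebra_simps)
qed

text \<open>By \<open>bezout\<close>, multiplying by \<open>u\<close> isolates \<open>x\<close>
  modulo \<open>p\<close>, and likewise for the other digits. The shift rules follow by exhibiting
  digits in range.\<close>

lemma coordinates_unique:
  assumes m: "m = x * (int q * int r) + y * (int p * int r) + z * (int p * int q)
      + t * (int p * int q * int r)"
    and "0 \<le> x" "x < int p" "0 \<le> y" "y < int q" "0 \<le> z" "z < int r"
  shows "X m = x" "Y m = y" "Z m = z" "T m = t"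
proof -
  define a b c where "a = int p" and "b = int q" and "c = int r"
  have u: "u * (b * c) = 1 - v * (a * c) - w * (a * b)"
    and v: "v * (a * c) = 1 - u * (b * c) - w * (a * b)"
    and w: "w * (a * b) = 1 - u * (b * c) - v * (a * c)"
    using bezout by (simp_all add: a_def b_def c_def)
  have m': "m = x * (b * c) + y * (a * c) + z * (a * b) + t * (a * b * c)"
    using m by (simp add: a_def b_def c_def)
  have "m * u = x * (u * (b * c)) + a * (y * c * u + z * b * u + t * b * c * u)"
    unfolding m' by (simp add: algebra_simps)
  also have "\<dots> = x + a * (y * c * u + z * b * u + t * b * c * u - x * (v * c + w * b))"
    unfolding u by (simp add: algebra_simps)
  finally show x: "X m = x" using assms by (simp add: X_def a_def)
  have "m * v = y * (v * (a * c)) + b * (x * c * v + z * a * v + t * a * c * v)"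
    unfolding m' by (simp add: algebra_simps)
  also have "\<dots> = y + b * (x * c * v + z * a * v + t * a * c * v - y * (u * c + w * a))"
    unfolding v by (simp add: algebra_simps)
  finally show y: "Y m = y" using assms by (simp add: Y_def b_def)
  have "m * w = z * (w * (a * b)) + c * (x * b * w + y * a * w + t * a * b * w)"
    unfolding m' by (simp add: algebra_simps)
  also have "\<dots> = z + c * (x * b * w + y * a * w + t * a * b * w - z * (u * b + v * a))"
    unfolding w by (simp add: algebra_simps)
  finally show z: "Z m = z" using assms by (simp add: Z_def c_def)
  have "T m * (int p * int q * int r) = t * (int p * int q * int r)"
    using decomposition[of m] m unfolding x y z by linarith
  then show "T m = t" using pos by simp
qed

lemma T_neg: "m < 0 \<Longrightarrow> T m < 0"
proof (rule ccontr)
  assume "m < 0" "\<not> T m < 0"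
  then have "0 \<le> T m * (int p * int q * int r)" using pos by simp
  moreover have "0 \<le> X m * (int q * int r)" "0 \<le> Y m * (int p * int r)" "0 \<le> Z m * (int p * int q)"
    using coordinates_range[of m] by simp_all
  ultimately show False using decomposition[of m] \<open>m < 0\<close> by linarith
qed

text \<open>Below \<open>p * q * r\<close> the weight \<open>max (T m + 1) 0\<close> is therefore 0
  or 1.\<close>

lemma T_nonpos: "m < int (p * q * r) \<Longrightarrow> T m \<le> 0"
proof (rule ccontr)
  assume m: "m < int (p * q * r)" and "\<not> T m \<le> 0"
  then have "1 * (int p * int q * int r) \<le> T m * (int p * int q * int r)"
    using pos by (intro mult_right_mono) auto
  moreover have "0 \<le> X m * (int q * int r)" "0 \<le> Y m * (int p * int r)" "0 \<le> Z m * (int p * int q)"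
    using coordinates_range[of m] by simp_all
  ultimately show False using decomposition[of m] m by simp
qed

text \<open>The first digit drops by one, borrowing from \<open>T\<close> when it is 0; the next two
  shifts work alike.\<close>

lemma shift_qr:
  "T (m - int (q * r)) = T m - of_bool (X m = 0)"
proof -
  have "m - int (q * r) = (if X m = 0 then int p - 1 else X m - 1) * (int q * int r)
      + Y m * (int p * int r) + Z m * (int p * int q)
      + (T m - of_bool (X m = 0)) * (int p * int q * int r)"
    using decomposition[of m] by (auto simp: algebra_simps)
  from coordinates_unique(4)[OF this] show ?thesis
    using coordinates_range[of m] pos by auto
qed

lemma shift_pr:
  "X (m - int (p * r)) = X m" (is ?X)
  "T (m - int (p * r)) = T m - of_bool (Y m = 0)" (is ?T)
proof -
  have "m - int (p * r) = X m * (int q * int r)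
      + (if Y m = 0 then int q - 1 else Y m - 1) * (int p * int r) + Z m * (int p * int q)
      + (T m - of_bool (Y m = 0)) * (int p * int q * int r)"
    using decomposition[of m] by (auto simp: algebra_simps)
  from coordinates_unique[OF this] show ?X ?T
    using coordinates_range[of m] pos by auto
qed

lemma shift_pq:
  "X (m - int (p * q)) = X m" (is ?X)
  "Y (m - int (p * q)) = Y m" (is ?Y)
  "T (m - int (p * q)) = T m - of_bool (Z m = 0)" (is ?T)
proof -
  have "m - int (p * q) = X m * (int q * int r) + Y m * (int p * int r)
      + (if Z m = 0 then int r - 1 else Z m - 1) * (int p * int q)
      + (T m - of_bool (Z m = 0)) * (int p * int q * int r)"
    using decomposition[of m] by (auto simp: algebra_simps)
  from coordinates_unique[OF this] show ?X ?Y ?T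
    using coordinates_range[of m] pos by auto
qed

text \<open>Modulo \<open>p\<close> the decomposition reduces to \<open>X m * q * r\<close>, so
  \<open>X m\<close> determines the residue of \<open>m\<close>.\<close>

lemma inj_on_X_window: "inj_on X {n - int p<..n}"
proof (rule inj_onI)
  fix m k assume mk: "m \<in> {n - int p<..n}" "k \<in> {n - int p<..n}" and "X m = X k"
  have "m - k = (X m - X k) * (int q * int r)
      + int p * ((Y m - Y k) * r + (Z m - Z k) * q + (T m - T k) * (q * r))"
    using decomposition[of m] decomposition[of k] by (simp add: algebra_simps)
  with \<open>X m = X k\<close> have "int p dvd m - k" by simp
  moreover have "\<bar>m - k\<bar> < int p" using mk by auto
  ultimately show "m = k"
    using dvd_imp_le_int[of "m - k" "int p"] by fastforce
qed

end

section \<open>Power series with integer coefficients\<close>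

text \<open>For functions on all integers that vanish at negative arguments, multiplication by a
  power of \<open>fps_X\<close> is a plain shift.\<close>

definition fps_of_int_fun :: "(int \<Rightarrow> int) \<Rightarrow> complex fps" where
  "fps_of_int_fun f = Abs_fps (\<lambda>n. of_int (f (int n)))"

lemma fps_of_int_fun_shift:
  assumes "\<And>m. m < 0 \<Longrightarrow> f m = 0"
  shows "fps_X ^ k * fps_of_int_fun f = fps_of_int_fun (\<lambda>m. f (m - int k))"
  by (rule fps_ext) (auto simp: fps_of_int_fun_def fps_X_power_mult_nth assms)

lemma fps_of_int_fun_difference:
  assumes "\<And>m. m < 0 \<Longrightarrow> f m = 0"
  shows "(1 - fps_X ^ k) * fps_of_int_fun f = fps_of_int_fun (\<lambda>m. f m - f (m - int k))"
proof -
  have "(1 - fps_X ^ k) * fps_of_int_fun f = fps_of_int_fun f - fps_of_int_fun (\<lambda>m. f (m - int k))"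
    by (simp add: left_diff_distrib fps_of_int_fun_shift[of f k, OF assms])
  also have "\<dots> = fps_of_int_fun (\<lambda>m. f m - f (m - int k))"
    by (rule fps_ext) (simp add: fps_of_int_fun_def)
  finally show ?thesis .
qed

lemma fps_of_int_fun_window:
  assumes "\<And>m. m < 0 \<Longrightarrow> f m = 0"
  shows "fps_nth ((\<Sum>i<k. fps_X ^ i) * fps_of_int_fun f) n = of_int (\<Sum>m\<in>{int n - int k<..int n}. f m)"
proof -
  have "fps_nth ((\<Sum>i<k. fps_X ^ i) * fps_of_int_fun f) n = of_int (\<Sum>i<k. f (int n - int i))"
    by (simp add: sum_distrib_right fps_sum_nth fps_of_int_fun_shift[OF assms])
       (simp add: fps_of_int_fun_def)
  also have "(\<Sum>i<k. f (int n - int i)) = (\<Sum>m\<in>{int n - int k<..int n}. f m)"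
    by (rule sum.reindex_bij_witness[where i = "\<lambda>m. nat (int n - m)" and j = "\<lambda>i. int n - int i"]) auto
  finally show ?thesis .
qed

section \<open>The weight series and the coefficients as window sums\<close>

context ternary_coordinates
begin

text \<open>For \<open>T m >= 0\<close> there are \<open>(T m + 2) choose 2\<close> ways to write
  \<open>m\<close> as \<open>a q r + b p r + c p q\<close> with nonnegative \<open>a\<close>,
  \<open>b\<close>, \<open>c\<close>; the factor \<open>1 - X^(pqr)\<close> takes the difference in
  \<open>T\<close>, leaving \<open>T m + 1\<close>.\<close>

definition weight :: "int \<Rightarrow> int" where "weight m = max (T m + 1) 0"

lemma weight_neg: "m < 0 \<Longrightarrow> weight m = 0"
  using T_neg[of m] by (simp add: weight_def)

text \<open>Each factor takes a difference. The first leaves the indicator of \<open>X m = 0\<close>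
  and \<open>T m >= 0\<close>, the second that of \<open>X m = Y m = T m = 0\<close>, the third only
  \<open>m = 0\<close> and, with sign -1, \<open>m = p * q * r\<close>.\<close>

lemma fps_weight:
  "(1 - fps_X ^ (p * q)) * ((1 - fps_X ^ (p * r)) * ((1 - fps_X ^ (q * r)) * fps_of_int_fun weight))
    = 1 - fps_X ^ (p * q * r)"
proof -
  define f1 where "f1 = (\<lambda>m. of_bool (X m = 0 \<and> T m \<ge> 0) :: int)"
  define f2 where "f2 = (\<lambda>m. of_bool (X m = 0 \<and> Y m = 0 \<and> T m = 0) :: int)"
  have neg: "f1 m = 0" "f2 m = 0" if "m < 0" for m
    using T_neg[OF that] by (auto simp: f1_def f2_def)
  have 1: "(\<lambda>m. weight m - weight (m - int (q * r))) = f1"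
    unfolding weight_def f1_def shift_qr by (rule ext) auto
  have 2: "(\<lambda>m. f1 m - f1 (m - int (p * r))) = f2"
    unfolding f1_def f2_def shift_pr by (rule ext) auto
  have 3: "f2 m - f2 (m - int (p * q)) = of_bool (m = 0) - of_bool (m = int (p * q * r))" for m
  proof -
    have "(X m = 0 \<and> Y m = 0 \<and> Z m = 0 \<and> T m = 0) \<longleftrightarrow> m = 0"
      using decomposition[of m] coordinates_unique[of 0 0 0 0 0] pos by auto
    moreover have "(X m = 0 \<and> Y m = 0 \<and> Z m = 0 \<and> T m = 1) \<longleftrightarrow> m = int (p * q * r)"
      using decomposition[of m] coordinates_unique[of m 0 0 0 1] pos by auto
    moreover have "f2 m - f2 (m - int (p * q)) = of_bool (X m = 0 \<and> Y m = 0 \<and> Z m = 0 \<and> T m = 0)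
        - of_bool (X m = 0 \<and> Y m = 0 \<and> Z m = 0 \<and> T m = 1)"
      unfolding f2_def shift_pq by (cases "Z m = 0") auto
    ultimately show ?thesis by simp
  qed
  have 4: "fps_of_int_fun (\<lambda>m. of_bool (m = 0) - of_bool (m = int (p * q * r))) = 1 - fps_X ^ (p * q * r)"
    by (rule fps_ext) (simp add: fps_of_int_fun_def fps_X_power_nth flip: of_nat_mult)
  show ?thesis
    using fps_of_int_fun_difference[of weight "q * r", OF weight_neg]
      fps_of_int_fun_difference[of f1 "p * r", OF neg(1)]
      fps_of_int_fun_difference[of f2 "p * q", OF neg(2)]
    unfolding 1 2 3 4 by simp
qed

definition ddiff :: "int \<Rightarrow> int" where
  "ddiff m = weight m - weight (m - int q) - weight (m - int r) + weight (m - int q - int r)"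

text \<open>Complex power series form an integral domain, so the denominators cancel. The quotient
  \<open>(1 - X^p) / (1 - X)\<close> supplies the window, the factors for \<open>q\<close> and
  \<open>r\<close> the second difference.\<close>

lemma cyclotomic_coeff_eq_window_sum:
  assumes "prime p" "prime q" "prime r" "p \<noteq> q" "p \<noteq> r" "q \<noteq> r"
  shows "coeff (cyclotomic (p * q * r)) n = of_int (\<Sum>m\<in>{int n - int p<..int n}. ddiff m)"
proof -
  define x :: "nat \<Rightarrow> complex fps" where "x = (\<lambda>k. 1 - fps_X ^ k)"
  define \<Phi> where "\<Phi> = fps_of_poly (cyclotomic (p * q * r))"
  define G where "G = fps_of_int_fun weight"
  have x0: "x k \<noteq> 0" if "k > 0" for k
  proof
    assume "x k = 0"
    then have "fps_nth (x k) 0 = 0" by simp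
    then show False using that by (simp add: x_def)
  qed
  have m: "fps_of_poly (monom 1 k - 1) = - x k" for k
    by (simp add: x_def fps_of_poly_diff fps_of_poly_monom')
  have 1: "\<Phi> * x 1 * x (p * q) * x (p * r) * x (q * r) = - (x (p * q * r) * x p * x q * x r) * (-1)"
    using arg_cong[OF cyclotomic_ternary[OF assms], of fps_of_poly]
    unfolding fps_of_poly_mult m \<Phi>_def by simp
  have 2: "x (p * q * r) = x (p * q) * (x (p * r) * (x (q * r) * G))"
    using fps_weight unfolding x_def G_def by simp
  define s where "s = (\<Sum>i<p. fps_X ^ i :: complex fps)"
  have 3: "x p = x 1 * s"
    unfolding x_def s_def by (simp add: one_diff_power_eq)
  have "(x 1 * x (p * q) * x (p * r) * x (q * r)) * \<Phi>
      = (x 1 * x (p * q) * x (p * r) * x (q * r)) * (s * (x q * (x r * G)))"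
    using 1 unfolding 2 3 by (simp add: mult_ac)
  moreover have "x 1 * x (p * q) * x (p * r) * x (q * r) \<noteq> 0"
    using x0 pos by simp
  ultimately have \<Phi>: "\<Phi> = s * (x q * (x r * G))" by simp
  have "x r * G = fps_of_int_fun (\<lambda>m. weight m - weight (m - int r))"
    unfolding x_def G_def by (rule fps_of_int_fun_difference) (rule weight_neg)
  moreover have "x q * fps_of_int_fun (\<lambda>m. weight m - weight (m - int r)) = fps_of_int_fun ddiff"
    unfolding x_def
    by (subst fps_of_int_fun_difference)
       (simp_all add: weight_neg ddiff_def[abs_def] algebra_simps)
  ultimately have "\<Phi> = s * fps_of_int_fun ddiff" using \<Phi> by simp
  moreover have "ddiff m = 0" if "m < 0" for m
    using that by (simp add: ddiff_def weight_neg)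
  ultimately show ?thesis
    using fps_of_int_fun_window[of ddiff p n] unfolding s_def \<Phi>_def
    by (metis fps_of_poly_nth)
qed

end

section \<open>Bounding the window sums\<close>

text \<open>\<open>P\<close> and \<open>R\<close> are the inverses of \<open>p\<close> modulo \<open>q\<close> and modulo \<open>r\<close>.\<close>

locale ternary_inverses = ternary_coordinates +
  fixes q' r' P R :: int
  assumes p_less: "p < q" "p < r"
    and q'_range: "0 < q'" "q' < int p" and r'_range: "0 < r'" "r' < int p"
    and P_range: "0 \<le> P" "P \<le> int q" and R_range: "0 \<le> R" "R \<le> int r"
    and inv_q: "q' * int q + P * int p = 1 + int p * int q"
    and inv_r: "r' * int r + R * int p = 1 + int p * int r"
begin

text \<open>By \<open>inv_r\<close>, \<open>q\<close> equals
  \<open>r' * (q r) + R * (p q) - p q r\<close>. Subtracting it raises \<open>T\<close> by one, less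
  one borrow for each digit that turns negative.\<close>

lemma shift_q:
  "T (m - int q) = T m + 1 - of_bool (X m < r') - of_bool (Z m < R)"
proof -
  have "int q = (r' * int r + R * int p - int p * int r) * int q"
    using inv_r by simp
  then have "m - int q = (X m - r' + of_bool (X m < r') * int p) * (int q * int r)
      + Y m * (int p * int r) + (Z m - R + of_bool (Z m < R) * int r) * (int p * int q)
      + (T m + 1 - of_bool (X m < r') - of_bool (Z m < R)) * (int p * int q * int r)"
    using decomposition[of m] by (simp add: algebra_simps)
  from coordinates_unique(4)[OF this] show ?thesis
    using coordinates_range[of m] r'_range R_range by auto
qed

lemma shift_r:
  "T (m - int r) = T m + 1 - of_bool (X m < q') - of_bool (Y m < P)" (is ?T)
  "X (m - int r) = X m - q' + of_bool (X m < q') * int p" (is ?X)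
  "Z (m - int r) = Z m" (is ?Z)
proof -
  have "int r = (q' * int q + P * int p - int p * int q) * int r"
    using inv_q by simp
  then have "m - int r = (X m - q' + of_bool (X m < q') * int p) * (int q * int r)
      + (Y m - P + of_bool (Y m < P) * int q) * (int p * int r) + Z m * (int p * int q)
      + (T m + 1 - of_bool (X m < q') - of_bool (Y m < P)) * (int p * int q * int r)"
    using decomposition[of m] by (simp add: algebra_simps)
  from coordinates_unique[OF this] show ?T ?X ?Z
    using coordinates_range[of m] q'_range P_range by auto
qed

lemma shift_q_r:
  "T (m - int q - int r) = T m + 2 - of_bool (X m < q') - of_bool (Y m < P)
    - of_bool (X m - q' + of_bool (X m < q') * int p < r') - of_bool (Z m < R)"
  using shift_q[of "m - int r"] by (simp add: shift_r algebra_simps)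

text \<open>All four weights are 0 or 1. The borrows in the first digit split \<open>X m\<close> at
  \<open>r'\<close>, \<open>q'\<close>, \<open>q' + r'\<close>. On the two ranges of length
  \<open>r'\<close> the second difference has a fixed sign and size at most 1; on the other two a
  single borrow pattern gives a nonzero value.\<close>

lemma ddiff_bounds_small:
  assumes m: "m < int (p * q * r)" and le: "r' \<le> q'" "q' + r' \<le> int p"
  shows "ddiff m \<le> of_bool (X m < r')
      + of_bool (q' + r' \<le> X m \<and> P \<le> Y m \<and> R \<le> Z m \<and> T m = -2)"
    and "- ddiff m \<le> of_bool (q' \<le> X m \<and> X m < q' + r')
      + of_bool (r' \<le> X m \<and> X m < q' \<and> Y m < P \<and> R \<le> Z m \<and> T m = -1)"
proof -
  have nonpos: "T m \<le> 0" "T (m - int q) \<le> 0" "T (m - int r) \<le> 0" "T (m - int q - int r) \<le> 0"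
    by (rule T_nonpos; use m in linarith)+
  have "ddiff m \<le> of_bool (X m < r')
      + of_bool (q' + r' \<le> X m \<and> P \<le> Y m \<and> R \<le> Z m \<and> T m = -2) \<and>
     - ddiff m \<le> of_bool (q' \<le> X m \<and> X m < q' + r')
      + of_bool (r' \<le> X m \<and> X m < q' \<and> Y m < P \<and> R \<le> Z m \<and> T m = -1)"
    using nonpos le q'_range r'_range coordinates_range(1,2)[of m] unfolding ddiff_def weight_def shift_q_r
    unfolding shift_q shift_r(1)
    by (cases "X m < r'"; cases "X m < q'"; cases "X m < q' + r'"; cases "Y m < P"; cases "Z m < R")
       (auto simp: max_def)
  then show "ddiff m \<le> of_bool (X m < r')
      + of_bool (q' + r' \<le> X m \<and> P \<le> Y m \<and> R \<le> Z m \<and> T m = -2)"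
    and "- ddiff m \<le> of_bool (q' \<le> X m \<and> X m < q' + r')
      + of_bool (r' \<le> X m \<and> X m < q' \<and> Y m < P \<and> R \<le> Z m \<and> T m = -1)"
    by blast+
qed

text \<open>The cuts are now \<open>q' + r' - p\<close>, \<open>r'\<close>, \<open>q'\<close>, and
  the two ranges of fixed sign have length \<open>p - q'\<close>.\<close>

lemma ddiff_bounds_large:
  assumes m: "m < int (p * q * r)" and le: "r' \<le> q'" "int p < q' + r'"
  shows "ddiff m \<le> of_bool (q' + r' - int p \<le> X m \<and> X m < r')
      + of_bool (X m < q' + r' - int p \<and> Y m < P \<and> Z m < R \<and> T m = 0)"
    and "- ddiff m \<le> of_bool (q' \<le> X m)
      + of_bool (r' \<le> X m \<and> X m < q' \<and> Y m < P \<and> R \<le> Z m \<and> T m = -1)"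
proof -
  have nonpos: "T m \<le> 0" "T (m - int q) \<le> 0" "T (m - int r) \<le> 0" "T (m - int q - int r) \<le> 0"
    by (rule T_nonpos; use m in linarith)+
  have "ddiff m \<le> of_bool (q' + r' - int p \<le> X m \<and> X m < r')
      + of_bool (X m < q' + r' - int p \<and> Y m < P \<and> Z m < R \<and> T m = 0) \<and>
     - ddiff m \<le> of_bool (q' \<le> X m)
      + of_bool (r' \<le> X m \<and> X m < q' \<and> Y m < P \<and> R \<le> Z m \<and> T m = -1)"
    using nonpos le q'_range r'_range coordinates_range(1,2)[of m] unfolding ddiff_def weight_def shift_q_r
    unfolding shift_q shift_r(1)
    by (cases "X m < q' + r' - int p"; cases "X m < r'"; cases "X m < q'"; cases "Y m < P"; cases "Z m < R")
       (auto simp: max_def)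
  then show "ddiff m \<le> of_bool (q' + r' - int p \<le> X m \<and> X m < r')
      + of_bool (X m < q' + r' - int p \<and> Y m < P \<and> Z m < R \<and> T m = 0)"
    and "- ddiff m \<le> of_bool (q' \<le> X m)
      + of_bool (r' \<le> X m \<and> X m < q' \<and> Y m < P \<and> R \<le> Z m \<and> T m = -1)"
    by blast+
qed

section \<open>Counting positions in the window\<close>

lemma window_count_le_length:
  assumes "\<And>m. m \<in> {n - int p<..n} \<Longrightarrow> Q m \<Longrightarrow> a \<le> X m \<and> X m < b" and "a \<le> b"
  shows "(\<Sum>m\<in>{n - int p<..n}. of_bool (Q m) :: int) \<le> b - a"
proof -
  have "(\<Sum>m\<in>{n - int p<..n}. of_bool (Q m) :: int) = int (card {m \<in> {n - int p<..n}. Q m})"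
    by (subst sum_of_bool_eq) (auto intro!: arg_cong[where f = card])
  also have "card {m \<in> {n - int p<..n}. Q m} \<le> card {a..<b}"
    by (rule card_inj_on_le[of X]) (use assms(1) in \<open>auto intro: inj_on_subset[OF inj_on_X_window]\<close>)
  finally show ?thesis using assms(2) by simp
qed

text \<open>An interval shorter than \<open>L * q * r\<close> contains at most \<open>L\<close>
  multiples of \<open>q * r\<close>; scaling avoids fractions.\<close>

lemma window_count_le_scaled_length:
  assumes "\<And>m. m \<in> {n - int p<..n} \<Longrightarrow> Q m \<Longrightarrow> lo \<le> X m * (int q * int r) \<and> X m * (int q * int r) \<le> hi"
    and "0 \<le> L" and "hi < lo + L * (int q * int r)"
  shows "(\<Sum>m\<in>{n - int p<..n}. of_bool (Q m) :: int) \<le> L"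
proof -
  define N where "N = int q * int r"
  have N: "N > 0" using pos by (simp add: N_def)
  \<comment> \<open>The ceiling of \<open>lo / N\<close>.\<close>
  define x0 where "x0 = - ((- lo) div N)"
  have "N * ((- lo) div N) + (- lo) mod N = - lo" "0 \<le> (- lo) mod N"
    using N by simp_all
  then have x0: "lo \<le> x0 * N"
    unfolding x0_def by (simp only: mult_minus_left mult.commute[of _ N])
  have "x0 \<le> X m \<and> X m < x0 + L" if m: "m \<in> {n - int p<..n}" "Q m" for m
  proof -
    have b: "lo \<le> X m * N" "X m * N \<le> hi" using assms(1)[OF m] by (simp_all add: N_def)
    have "((- X m) * N) div N \<le> (- lo) div N"
      using b N by (intro zdiv_mono1) auto
    moreover have "((- X m) * N) div N = - X m"
      using N by (intro nonzero_mult_div_cancel_right) auto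
    ultimately have "x0 \<le> X m" by (simp add: x0_def)
    moreover have "X m * N < (x0 + L) * N"
      using b x0 assms(3) unfolding N_def[symmetric] distrib_right by linarith
    then have "X m < x0 + L" using N by simp
    ultimately show ?thesis by simp
  qed
  from window_count_le_length[OF this] assms(2) show ?thesis by simp
qed

lemma scaled_bounds:
  "a \<le> Y m \<Longrightarrow> a * (int p * int r) \<le> Y m * (int p * int r)"
  "Y m < a \<Longrightarrow> Y m * (int p * int r) \<le> a * (int p * int r) - int p * int r"
  "a \<le> Z m \<Longrightarrow> a * (int p * int q) \<le> Z m * (int p * int q)"
  "Z m < a \<Longrightarrow> Z m * (int p * int q) \<le> a * (int p * int q) - int p * int q"
proof -
  show "a \<le> Y m \<Longrightarrow> a * (int p * int r) \<le> Y m * (int p * int r)"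
    "a \<le> Z m \<Longrightarrow> a * (int p * int q) \<le> Z m * (int p * int q)"
    by (rule mult_right_mono; simp)+
  show "Y m * (int p * int r) \<le> a * (int p * int r) - int p * int r" if "Y m < a"
    using mult_right_mono[of "Y m" "a - 1" "int p * int r"] that by (simp add: algebra_simps)
  show "Z m * (int p * int q) \<le> a * (int p * int q) - int p * int q" if "Z m < a"
    using mult_right_mono[of "Z m" "a - 1" "int p * int q"] that by (simp add: algebra_simps)
qed

text \<open>Divided by \<open>p q r\<close>, these read
  \<open>P / q = 1 - q' / p + 1 / (p q)\<close> and likewise for \<open>R / r\<close>; they make
  bounds on \<open>Y\<close> and \<open>Z\<close> comparable with \<open>X\<close>.\<close>

lemma scaled_inverses:
  "P * (int p * int r) = int r + int p * int q * int r - q' * (int q * int r)"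
  "R * (int p * int q) = int q + int p * int q * int r - r' * (int q * int r)"
proof -
  have "P * int p = 1 + int p * int q - q' * int q" "R * int p = 1 + int p * int r - r' * int r"
    using inv_q inv_r by simp_all
  then have "(P * int p) * int r = (1 + int p * int q - q' * int q) * int r"
    "(R * int p) * int q = (1 + int p * int r - r' * int r) * int q" by simp_all
  then show "P * (int p * int r) = int r + int p * int q * int r - q' * (int q * int r)"
    "R * (int p * int q) = int q + int p * int q * int r - r' * (int q * int r)"
    by (simp_all add: algebra_simps)
qed

text \<open>The variation \<open>p - 1\<close> of \<open>m\<close> on the window and the error terms
  \<open>q\<close>, \<open>r\<close> of \<open>scaled_inverses\<close> are outweighed by what strict
  bounds on \<open>Y m\<close> and \<open>Z m\<close> gain.\<close>

lemma pr_pq_large: "int p - 1 + int q + int r < int p * int r + int p * int q"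
proof -
  have "2 * int r \<le> int p * int r" "2 * int q \<le> int p * int q"
    using q'_range by (auto intro!: mult_right_mono)
  then show ?thesis using p_less by linarith
qed

text \<open>With \<open>T m\<close> fixed and \<open>Y m\<close>, \<open>Z m\<close> confined to short ranges, the decomposition of \<open>m\<close>
  confines \<open>X m\<close> to a short interval, because \<open>m\<close> itself is nearly constant on the window.\<close>

lemma count_high_high:
  "(\<Sum>m\<in>{n - int p<..n}. of_bool (q' + r' \<le> X m \<and> P \<le> Y m \<and> R \<le> Z m \<and> T m = -2) :: int) \<le> q' + r'"
proof (rule window_count_le_scaled_length)
  fix m assume m: "m \<in> {n - int p<..n}"
    and Q: "q' + r' \<le> X m \<and> P \<le> Y m \<and> R \<le> Z m \<and> T m = -2"
  \<comment> \<open>The left end uses \<open>Y m <= q - 1\<close> and \<open>Z m <= r - 1\<close>,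
    the right end \<open>P <= Y m\<close> and \<open>R <= Z m\<close>.\<close>
  show "n - int p + 1 + int p * int r + int p * int q \<le> X m * (int q * int r) \<and>
    X m * (int q * int r) \<le> n + q' * (int q * int r) + r' * (int q * int r) - int r - int q"
    using decomposition[of m] m Q scaled_inverses
      scaled_bounds(1)[of P m] scaled_bounds(3)[of R m]
      scaled_bounds(2)[of m "int q"] scaled_bounds(4)[of m "int r"] coordinates_range[of m]
    by (auto simp: mult_ac)
qed (use q'_range r'_range pr_pq_large in \<open>auto simp: distrib_right\<close>)

text \<open>Up to small errors \<open>Y / q\<close> varies over length \<open>1 - q' / p\<close> and
  \<open>Z / r\<close> over \<open>r' / p\<close>; \<open>p\<close> times the sum is the
  bound.\<close>

lemma count_low_high:
  "(\<Sum>m\<in>{n - int p<..n}. of_bool (r' \<le> X m \<and> X m < q' \<and> Y m < P \<and> R \<le> Z m \<and> T m = -1) :: int)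
    \<le> r' + int p - q'"
proof (rule window_count_le_scaled_length)
  fix m assume m: "m \<in> {n - int p<..n}"
    and Q: "r' \<le> X m \<and> X m < q' \<and> Y m < P \<and> R \<le> Z m \<and> T m = -1"
  have bnds: "R * (int p * int q) \<le> Z m * (int p * int q)"
    "Y m * (int p * int r) \<le> P * (int p * int r) - int p * int r"
    "Z m * (int p * int q) \<le> int p * int q * int r - int p * int q"
    using Q coordinates_range[of m] scaled_bounds(2)[of m P] scaled_bounds(3)[of R m]
      scaled_bounds(4)[of m "int r"] by (auto simp: mult_ac)
  have "m = X m * (int q * int r) + Y m * (int p * int r) + Z m * (int p * int q) - int p * int q * int r"
    using decomposition[of m] Q by (simp add: mult_ac)
  moreover have "0 \<le> Y m * (int p * int r)" "0 \<le> Z m * (int p * int q)"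
    using coordinates_range[of m] by simp_all
  ultimately show "n - int p + 1 - int r - int p * int q * int r + q' * (int q * int r) + int p * int r + int p * int q
     \<le> X m * (int q * int r) \<and>
    X m * (int q * int r) \<le> n + r' * (int q * int r) - int q"
    using m scaled_inverses bnds
    unfolding greaterThanAtMost_iff by (intro conjI; elim conjE; linarith)
qed (use q'_range r'_range pr_pq_large in \<open>auto simp: distrib_right left_diff_distrib\<close>)

text \<open>Here the lengths are about \<open>1 - q' / p\<close> and
  \<open>1 - r' / p\<close>.\<close>

lemma count_low_low:
  "(\<Sum>m\<in>{n - int p<..n}. of_bool (X m < q' + r' - int p \<and> Y m < P \<and> Z m < R \<and> T m = 0) :: int)
    \<le> 2 * int p - q' - r'"
proof (rule window_count_le_scaled_length)
  fix m assume m: "m \<in> {n - int p<..n}"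
    and Q: "X m < q' + r' - int p \<and> Y m < P \<and> Z m < R \<and> T m = 0"
  have "m = X m * (int q * int r) + Y m * (int p * int r) + Z m * (int p * int q)"
    using decomposition[of m] Q by (simp add: mult_ac)
  moreover have "0 \<le> Y m * (int p * int r)" "0 \<le> Z m * (int p * int q)"
    using coordinates_range[of m] by simp_all
  ultimately show "n - int p + 1 - int r - int q + int p * int r + int p * int q - 2 * (int p * (int q * int r))
       + q' * (int q * int r) + r' * (int q * int r)
     \<le> X m * (int q * int r) \<and> X m * (int q * int r) \<le> n"
    using m Q scaled_inverses
      scaled_bounds(2)[of m P] scaled_bounds(4)[of m R] coordinates_range[of m]
    unfolding greaterThanAtMost_iff by (intro conjI) linarith+
qed (use q'_range r'_range pr_pq_large in \<open>auto simp: distrib_right left_diff_distrib\<close>)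

section \<open>Bounds on the window sums\<close>

lemma le_min_add:
  fixes s a b A B C D E :: int
  assumes "s \<le> a + b" "a \<le> A" "b \<le> B" "b \<le> C" "A + B = D" "A + C = E"
  shows "s \<le> min D E"
  using assms by simp

text \<open>The long range is counted both by its length and by the scaled interval. The two minima
  differ by exchanging \<open>q'\<close> and \<open>p - q'\<close>, so with
  \<open>\<alpha> = r'\<close> and \<open>\<beta>s = min q' (p - q')\<close> both stay within the
  claimed bound.\<close>

lemma window_sum_bounds_small:
  assumes n: "n < int (p * q * r)" and le: "r' \<le> q'" "q' + r' \<le> int p"
  shows "(\<Sum>m\<in>{n - int p<..n}. ddiff m) \<le> min (int p - q') (2 * r' + q')"
    and "- (\<Sum>m\<in>{n - int p<..n}. ddiff m) \<le> min q' (2 * r' + (int p - q'))"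
proof -
  let ?W = "{n - int p<..n}"
  have 1: "(\<Sum>m\<in>?W. ddiff m) \<le> (\<Sum>m\<in>?W. of_bool (X m < r'))
      + (\<Sum>m\<in>?W. of_bool (q' + r' \<le> X m \<and> P \<le> Y m \<and> R \<le> Z m \<and> T m = -2))"
    unfolding sum.distrib[symmetric] by (rule sum_mono, rule ddiff_bounds_small) (use n le in auto)
  have 2: "(\<Sum>m\<in>?W. of_bool (X m < r') :: int) \<le> r' - 0"
    by (rule window_count_le_length) (use coordinates_range r'_range in auto)
  have 3: "(\<Sum>m\<in>?W. of_bool (q' + r' \<le> X m \<and> P \<le> Y m \<and> R \<le> Z m \<and> T m = -2) :: int)
      \<le> int p - (q' + r')"
    by (rule window_count_le_length) (use coordinates_range le in auto)
  show "(\<Sum>m\<in>?W. ddiff m) \<le> min (int p - q') (2 * r' + q')"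
    by (rule le_min_add[OF 1 2 3 count_high_high]) simp_all
  have 1: "- (\<Sum>m\<in>?W. ddiff m) \<le> (\<Sum>m\<in>?W. of_bool (q' \<le> X m \<and> X m < q' + r'))
      + (\<Sum>m\<in>?W. of_bool (r' \<le> X m \<and> X m < q' \<and> Y m < P \<and> R \<le> Z m \<and> T m = -1))"
    unfolding sum.distrib[symmetric] sum_negf[symmetric]
    by (rule sum_mono, rule ddiff_bounds_small) (use n le in auto)
  have 2: "(\<Sum>m\<in>?W. of_bool (q' \<le> X m \<and> X m < q' + r') :: int) \<le> (q' + r') - q'"
    by (rule window_count_le_length) (use r'_range in auto)
  have 3: "(\<Sum>m\<in>?W. of_bool (r' \<le> X m \<and> X m < q' \<and> Y m < P \<and> R \<le> Z m \<and> T m = -1) :: int)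
      \<le> q' - r'"
    by (rule window_count_le_length) (use le in auto)
  show "- (\<Sum>m\<in>?W. ddiff m) \<le> min q' (2 * r' + (int p - q'))"
    by (rule le_min_add[OF 1 2 3 count_low_high]) simp_all
qed

text \<open>Same scheme, for \<open>\<alpha> = p - q'\<close> and
  \<open>\<beta>s = min r' (p - r')\<close>.\<close>

lemma window_sum_bounds_large:
  assumes n: "n < int (p * q * r)" and le: "r' \<le> q'" "int p < q' + r'"
  shows "(\<Sum>m\<in>{n - int p<..n}. ddiff m) \<le> min r' (2 * (int p - q') + (int p - r'))"
    and "- (\<Sum>m\<in>{n - int p<..n}. ddiff m) \<le> min (int p - r') (2 * (int p - q') + r')"
proof -
  let ?W = "{n - int p<..n}"
  have 1: "(\<Sum>m\<in>?W. ddiff m) \<le> (\<Sum>m\<in>?W. of_bool (q' + r' - int p \<le> X m \<and> X m < r'))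
      + (\<Sum>m\<in>?W. of_bool (X m < q' + r' - int p \<and> Y m < P \<and> Z m < R \<and> T m = 0))"
    unfolding sum.distrib[symmetric] by (rule sum_mono, rule ddiff_bounds_large) (use n le in auto)
  have 2: "(\<Sum>m\<in>?W. of_bool (q' + r' - int p \<le> X m \<and> X m < r') :: int) \<le> r' - (q' + r' - int p)"
    by (rule window_count_le_length) (use q'_range in auto)
  have 3: "(\<Sum>m\<in>?W. of_bool (X m < q' + r' - int p \<and> Y m < P \<and> Z m < R \<and> T m = 0) :: int)
      \<le> (q' + r' - int p) - 0"
    by (rule window_count_le_length) (use coordinates_range le in auto)
  show "(\<Sum>m\<in>?W. ddiff m) \<le> min r' (2 * (int p - q') + (int p - r'))"
    by (rule le_min_add[OF 1 2 3 count_low_low]) simp_all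
  have 1: "- (\<Sum>m\<in>?W. ddiff m) \<le> (\<Sum>m\<in>?W. of_bool (q' \<le> X m))
      + (\<Sum>m\<in>?W. of_bool (r' \<le> X m \<and> X m < q' \<and> Y m < P \<and> R \<le> Z m \<and> T m = -1))"
    unfolding sum.distrib[symmetric] sum_negf[symmetric]
    by (rule sum_mono, rule ddiff_bounds_large) (use n le in auto)
  have 2: "(\<Sum>m\<in>?W. of_bool (q' \<le> X m) :: int) \<le> int p - q'"
    by (rule window_count_le_length) (use coordinates_range q'_range in auto)
  have 3: "(\<Sum>m\<in>?W. of_bool (r' \<le> X m \<and> X m < q' \<and> Y m < P \<and> R \<le> Z m \<and> T m = -1) :: int)
      \<le> q' - r'"
    by (rule window_count_le_length) (use le in auto)
  show "- (\<Sum>m\<in>?W. ddiff m) \<le> min (int p - r') (2 * (int p - q') + r')"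
    by (rule le_min_add[OF 1 2 3 count_low_high]) simp_all
qed

end

section \<open>The theorem\<close>

lemma max_abs_coeff_le:
  assumes "n > 0" and "\<And>m. m < n \<Longrightarrow> cmod (coeff (cyclotomic n) m) \<le> B"
  shows "max_abs_coeff n \<le> B"
  unfolding max_abs_coeff_def cyc_coeff_def
  using assms degree_cyclotomic_less[OF assms(1)] by (subst Max_le_iff) auto

section \<open>Inverses and the value of \<open>\<beta>\<close>\<close>

lemma ternary_bezout:
  fixes p q r :: int
  assumes "coprime p q" "coprime p r" "coprime q r"
  shows "\<exists>u v w. u * (q * r) + v * (p * r) + w * (p * q) = 1"
proof -
  have "coprime (q * r) p" using assms by (simp add: coprime_commute)
  then obtain a b where ab: "a * (q * r) + b * p = 1"
    using bezout_int[of "q * r" p] by (auto simp: coprime_iff_gcd_eq_1)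
  obtain c d where cd: "c * r + d * q = 1"
    using bezout_int[of r q] assms(3) by (auto simp: coprime_iff_gcd_eq_1 gcd.commute)
  have "a * (q * r) + (b * c) * (p * r) + (b * d) * (p * q) = a * (q * r) + b * p * (c * r + d * q)"
    by (simp add: algebra_simps)
  also have "\<dots> = 1" using ab cd by simp
  finally show ?thesis by blast
qed

lemma complementary_inverse:
  fixes p q q' :: nat
  assumes "0 < p" "0 < q" "0 < q'" "q' < p" "[q * q' = 1] (mod p)"
  shows "\<exists>P. 0 \<le> P \<and> P \<le> int q \<and> int q' * int q + P * int p = 1 + int p * int q"
proof -
  have "[int q * int q' = 1] (mod int p)"
    using assms(5) by (metis cong_int_iff of_nat_1 of_nat_mult)
  then have "int p dvd 1 - int q * int q'"
    by (meson cong_iff_dvd_diff cong_sym)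
  then obtain k where k: "1 - int q * int q' = int p * k" by (elim dvdE)
  \<comment> \<open>\<open>k\<close> inverts \<open>p\<close> modulo \<open>q\<close> but is at most
    0; adding \<open>q\<close> brings it into range.\<close>
  define P where "P = k + int q"
  have P: "int q' * int q + P * int p = 1 + int p * int q"
    using k by (simp add: P_def algebra_simps)
  have "int q' * int q \<le> int p * int q" using assms by (intro mult_right_mono) auto
  then have "0 < P * int p" using P by linarith
  then have "0 \<le> P" using assms by (simp add: zero_less_mult_iff)
  moreover have "1 * 1 \<le> int q' * int q" using assms by (intro mult_mono) auto
  then have "P * int p \<le> int q * int p" using P by (simp add: mult.commute)
  then have "P \<le> int q" using assms by simp
  ultimately show ?thesis using P by blast
qed

lemma int_eq_if_dvd_diff:
  fixes a b n :: int
  assumes "n dvd a - b" "0 \<le> a" "a < n" "0 \<le> b" "b < n"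
  shows "a = b"
  using assms by (metis mod_eq_dvd_iff mod_pos_pos_trivial)

text \<open>If \<open>q' + r' <= p\<close>, then \<open>\<alpha> = r'\<close> and the congruence
  forces \<open>\<beta> = q'\<close>; otherwise \<open>\<alpha> = p - q'\<close> and
  \<open>\<beta> = p - r'\<close>. The window bounds then apply.\<close>

lemma ternary_bound_ordered:
  fixes p q r q' r' \<alpha> \<beta> \<beta>s :: nat
  assumes primes: "prime p" "prime q" "prime r"
    and less: "p < q" "p < r" "q \<noteq> r"
    and q': "q' \<in> {1..p-1}" "[q * q' = 1] (mod p)"
    and r': "r' \<in> {1..p-1}" "[r * r' = 1] (mod p)"
    and \<alpha>: "\<alpha> = Min {q', r', p - q', p - r'}"
    and \<beta>: "0 < \<beta>" "\<beta> < p" "[\<alpha> * \<beta> * q * r = 1] (mod p)"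
    and \<beta>s: "\<beta>s = min \<beta> (p - \<beta>)"
    and le: "r' \<le> q'"
  shows "max_abs_coeff (p * q * r) \<le> real (min (2 * \<alpha> + \<beta>s) (p - \<beta>s))"
proof -
  have pos: "0 < p" "0 < q" "0 < r" using primes prime_gt_0_nat by auto
  have cop: "coprime p q" "coprime p r" "coprime q r"
    using primes less by (auto intro: primes_coprime)
  obtain u v w where bz: "u * (int q * int r) + v * (int p * int r) + w * (int p * int q) = 1"
    using ternary_bezout[of "int p" "int q" "int r"] cop by auto
  have q'r': "0 < q'" "q' < p" "0 < r'" "r' < p" using q' r' pos by auto
  obtain P where P: "0 \<le> P" "P \<le> int q" "int q' * int q + P * int p = 1 + int p * int q"
    using complementary_inverse[of p q q'] pos q'r' q' by auto
  obtain R where R: "0 \<le> R" "R \<le> int r" "int r' * int r + R * int p = 1 + int p * int r"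
    using complementary_inverse[of p r r'] pos q'r' r' by auto
  interpret ternary_inverses p q r u v w "int q'" "int r'" P R
    by unfold_locales (use pos bz q'r' less P R in auto)
  have "[int (\<alpha> * \<beta> * q * r) = int 1] (mod int p)" "[int (q * q') = int 1] (mod int p)"
    "[int (r * r') = int 1] (mod int p)"
    using \<beta>(3) q'(2) r'(2) unfolding cong_int_iff by simp_all
  then obtain k1 k2 k3 where k: "int \<alpha> * int \<beta> * int q * int r = 1 + int p * k1"
    "int q * int q' = 1 + int p * k2" "int r * int r' = 1 + int p * k3"
    by (auto simp: cong_iff_dvd_diff elim!: dvdE) (metis diff_add_cancel add.commute)
  have prod: "(int q * int q') * (int r * int r') = 1 + int p * (k2 + k3 + int p * k2 * k3)"
    unfolding k by (simp add: algebra_simps)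
  have bound: "\<bar>\<Sum>m\<in>{int n - int p<..int n}. ddiff m\<bar> \<le> int (min (2 * \<alpha> + \<beta>s) (p - \<beta>s))"
    if n: "n < p * q * r" for n
  proof -
    define S where "S = (\<Sum>m\<in>{int n - int p<..int n}. ddiff m)"
    have n': "int n < int (p * q * r)" using n by (simp only: of_nat_less_iff)
    show ?thesis
    proof (cases "q' + r' \<le> p")
      case True
      have \<alpha>r: "\<alpha> = r'" unfolding \<alpha> using True le by simp
      \<comment> \<open>The congruence for \<open>\<beta>\<close> is multiplied by
        \<open>q'\<close>, and the inverse pairs \<open>q q'\<close> and \<open>r r'\<close> are
        replaced by 1 modulo \<open>p\<close>.\<close>
      have "int \<beta> - int q' = int p * (k1 * int q' - (k2 + k3 + int p * k2 * k3) * int \<beta>)"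
      proof -
        have "(1 + int p * k1) * int q' = (int q * int q') * (int r * int r') * int \<beta>"
          unfolding k(1)[symmetric] \<alpha>r by (simp add: mult_ac)
        also have "\<dots> = (1 + int p * (k2 + k3 + int p * k2 * k3)) * int \<beta>" unfolding prod ..
        finally show ?thesis by (simp add: algebra_simps)
      qed
      then have "int p dvd int \<beta> - int q'" by simp
      then have "int \<beta> = int q'"
        by (rule int_eq_if_dvd_diff) (use \<beta> q'r' in auto)
      then have "\<beta> = q'" by simp
      moreover have "int r' \<le> int q'" "int q' + int r' \<le> int p"
        using le True by linarith+
      note window_sum_bounds_small[OF n' this]
      ultimately show ?thesis
        using q'r' le True unfolding S_def[symmetric] \<beta>s \<alpha>r
        by (auto simp: min_def abs_le_iff split: if_splits)
    next
      case False
      have \<alpha>q: "\<alpha> = p - q'" unfolding \<alpha> using False le by simp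
      have "int \<beta> - int (p - r') = int p * (int r' * int \<beta> * int q * int r - k1 * int r'
          - (k2 + k3 + int p * k2 * k3) * int \<beta> - 1)"
      proof -
        have "(1 + int p * k1) * int r'
            = int p * int \<beta> * int q * int r * int r' - (int q * int q') * (int r * int r') * int \<beta>"
          unfolding k(1)[symmetric] \<alpha>q using q'r' by (simp add: of_nat_diff algebra_simps)
        also have "\<dots> = int p * int \<beta> * int q * int r * int r'
            - (1 + int p * (k2 + k3 + int p * k2 * k3)) * int \<beta>" unfolding prod ..
        finally show ?thesis using q'r' by (simp add: of_nat_diff algebra_simps)
      qed
      then have "int p dvd int \<beta> - int (p - r')" by simp
      then have "int \<beta> = int (p - r')"
        by (rule int_eq_if_dvd_diff) (use \<beta> q'r' in auto)
      then have "\<beta> = p - r'" by linarith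
      moreover have "int r' \<le> int q'" "int p < int q' + int r'"
        using le False by linarith+
      note window_sum_bounds_large[OF n' this]
      ultimately show ?thesis
        using q'r' le False unfolding S_def[symmetric] \<beta>s \<alpha>q
        by (auto simp: min_def abs_le_iff split: if_splits)
    qed
  qed
  show ?thesis
  proof (rule max_abs_coeff_le)
    show "p * q * r > 0" using pos by simp
    fix n assume "n < p * q * r"
    have "coeff (cyclotomic (p * q * r)) n = of_int (\<Sum>m\<in>{int n - int p<..int n}. ddiff m)"
      by (rule cyclotomic_coeff_eq_window_sum) (use primes less in auto)
    then have "cmod (coeff (cyclotomic (p * q * r)) n)
        = real_of_int \<bar>\<Sum>m\<in>{int n - int p<..int n}. ddiff m\<bar>"
      by (simp only: norm_of_int of_int_abs)
    also have "\<dots> \<le> real_of_int (int (min (2 * \<alpha> + \<beta>s) (p - \<beta>s)))"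
      using bound[OF \<open>n < p * q * r\<close>] by (simp only: of_int_le_iff)
    finally show "cmod (coeff (cyclotomic (p * q * r)) n) \<le> real (min (2 * \<alpha> + \<beta>s) (p - \<beta>s))"
      by simp
  qed
qed

theorem theorem2:
  fixes p q r q' r' \<alpha> \<beta> \<beta>s :: nat
  assumes "prime p" and "prime q" and "prime r"
    and "p < q" and "p < r" and "q \<noteq> r"
    and "q' \<in> {1..p-1}" and "[q * q' = 1] (mod p)"
    and "r' \<in> {1..p-1}" and "[r * r' = 1] (mod p)"
    and "\<alpha> = Min {q', r', p - q', p - r'}"
    and "0 < \<beta>" and "\<beta> < p" and "[\<alpha> * \<beta> * q * r = 1] (mod p)"
    and "\<beta>s = min \<beta> (p - \<beta>)"
  shows "max_abs_coeff (p * q * r) \<le> real (min (2 * \<alpha> + \<beta>s) (p - \<beta>s))"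
proof (cases "r' \<le> q'")
  case True
  then show ?thesis by (intro ternary_bound_ordered[OF assms])
next
  case False
  \<comment> \<open>The claim is symmetric under exchanging \<open>q\<close>, \<open>q'\<close> with
    \<open>r\<close>, \<open>r'\<close>.\<close>
  have "\<alpha> = Min {r', q', p - r', p - q'}"
    unfolding assms(11) by (rule arg_cong[where f = Min]) auto
  moreover have "[\<alpha> * \<beta> * r * q = 1] (mod p)"
    using assms(14) by (simp only: mult.assoc mult.commute[of q r])
  ultimately have "max_abs_coeff (p * r * q) \<le> real (min (2 * \<alpha> + \<beta>s) (p - \<beta>s))"
    using False assms(6)
    by (intro ternary_bound_ordered[OF assms(1,3,2,5,4) _ assms(9,10,7,8) _ assms(12,13) _ assms(15)]) auto
  then show ?thesis by (simp only: mult.assoc mult.commute[of q r])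
qed

end
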